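(* Let $r>r_0>0$ be real numbers, let $N>1$ and $d>1$ be integers, and let $P:=\{\mathbf{p}_1,\mathbf{p}_2,\dots,\mathbf{p}_N\}\subset\mathbb{E}^d$ be a set of points whose circumradius is $r_{cr}(P)=r_0$. Then $$V_d(P^r)\leq V_d(L_{r,\,r-r_0,\,d}).$$
   Context: $\mathbb{E}^d$ is $d$-dimensional Euclidean space, $\mathbf{B}^d[\mathbf{p},r]$ is the closed ball of radius $r$ centered at $\mathbf{p}$, and $V_d$ is $d$-dimensional Lebesgue measure (volume). For a nonempty set $X\subseteq\mathbb{E}^d$ and $r>0$, the $r$-ball body generated by $X$ is $X^r:=\bigcap_{\mathbf{x}\in X}\mathbf{B}^d[\mathbf{x},r]$. The circumradius $r_{cr}(X)$ of a bounded set $X$ is the radius of the smallest closed ball containing $X$; the inradius of a convex body is the radius of the largest ball contained in it. An $r$-lense is an intersection of two closed balls of radius $r$ in $\mathbb{E}^d$. For $r\geq\rho>0$, $L_{r,\rho,d}$ denotes an $r$-lense in $\mathbb{E}^d$ whose inradius is $\rho$ (unique up to congruence: the centers of the two balls are at distance $2(r-\rho)$). *)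

theory Defs
  imports "HOL-Analysis.Analysis"
begin

definition ball_body :: "real \<Rightarrow> 'a::metric_space set \<Rightarrow> 'a set" where
  "ball_body r X = (\<Inter>x\<in>X. cball x r)"

text \<open>For a nonempty bounded \<open>X\<close> in a Euclidean space the infimum is attained, so it is the radius
  of the smallest closed ball containing \<open>X\<close>.\<close>

definition circumradius :: "'a::metric_space set \<Rightarrow> real" where
  "circumradius X = Inf {R. R \<ge> 0 \<and> (\<exists>c. X \<subseteq> cball c R)}"

text \<open>For a nonempty compact \<open>K\<close> in a Euclidean space of positive dimension the supremum is
  attained, so it is the radius of the largest ball contained in \<open>K\<close>.\<close>

definition inradius :: "'a::metric_space set \<Rightarrow> real" where
  "inradius K = Sup {s. s \<ge> 0 \<and> (\<exists>c. cball c s \<subseteq> K)}"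

text \<open>A lense must be nonempty: the inradius of the empty set would be \<open>Sup {}\<close>, which is an
  unspecified real number.\<close>

definition is_lense :: "real \<Rightarrow> 'a::metric_space set \<Rightarrow> bool" where
  "is_lense r L \<longleftrightarrow> L \<noteq> {} \<and> (\<exists>a b. L = cball a r \<inter> cball b r)"

text \<open>For \<open>0 \<le> \<rho> \<le> r\<close> there is an \<open>r\<close>-lense of inradius \<open>\<rho>\<close>, and it is unique up to congruence: the
  inradius determines the distance of the two centers.\<close>

lemma inradius_lense:
  fixes a b :: "'a::euclidean_space"
  assumes "dist a b \<le> 2 * r"
  shows "inradius (cball a r \<inter> cball b r) = r - dist a b / 2"
  unfolding inradius_def
proof (rule cSup_eq_maximum)
  have "cball (midpoint a b) (r - dist a b / 2) \<subseteq> cball a r \<inter> cball b r"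
    by (simp add: cball_subset_cball_iff dist_midpoint)
  then show "r - dist a b / 2 \<in> {s. s \<ge> 0 \<and> (\<exists>c. cball c s \<subseteq> cball a r \<inter> cball b r)}"
    using assms by auto
next
  fix s assume "s \<in> {s. s \<ge> 0 \<and> (\<exists>c. cball c s \<subseteq> cball a r \<inter> cball b r)}"
  then obtain c where "s \<ge> 0" "cball c s \<subseteq> cball a r" "cball c s \<subseteq> cball b r"
    by auto
  then have "dist c a + s \<le> r" "dist c b + s \<le> r"
    by (auto simp: cball_subset_cball_iff)
  then show "s \<le> r - dist a b / 2"
    using dist_triangle3[of a b c] by simp
qed

lemma lense_inradius_iff:
  fixes L :: "'a::euclidean_space set"
  assumes "0 \<le> \<rho>" "\<rho> \<le> r"
  shows "is_lense r L \<and> inradius L = \<rho> \<longleftrightarrow>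
    (\<exists>a b. dist a b = 2 * (r - \<rho>) \<and> L = cball a r \<inter> cball b r)"
proof
  assume L: "is_lense r L \<and> inradius L = \<rho>"
  then obtain a b x where ab: "L = cball a r \<inter> cball b r" and "x \<in> L"
    unfolding is_lense_def by blast
  then have "dist a b \<le> 2 * r"
    using dist_triangle2[of a b x] by auto
  with L ab have "dist a b = 2 * (r - \<rho>)"
    using inradius_lense[of a b r] by simp
  with ab show "\<exists>a b. dist a b = 2 * (r - \<rho>) \<and> L = cball a r \<inter> cball b r"
    by blast
next
  assume "\<exists>a b. dist a b = 2 * (r - \<rho>) \<and> L = cball a r \<inter> cball b r"
  then obtain a b where ab: "dist a b = 2 * (r - \<rho>)" "L = cball a r \<inter> cball b r"
    by blast
  have "midpoint a b \<in> L"
    using ab assms by (simp add: dist_midpoint)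
  then show "is_lense r L \<and> inradius L = \<rho>"
    using ab assms inradius_lense[of a b r] unfolding is_lense_def
    by (auto simp: field_simps)
qed

lemma lense_exists:
  assumes "0 \<le> \<rho>" "\<rho> \<le> r"
  shows "\<exists>L :: 'a::euclidean_space set. is_lense r L \<and> inradius L = \<rho>"
proof -
  obtain b :: 'a where "norm b = 2 * (r - \<rho>)"
    using vector_choose_size[of "2 * (r - \<rho>)"] assms by auto
  then have "dist 0 b = 2 * (r - \<rho>)" by simp
  then show ?thesis
    using lense_inradius_iff[OF assms] by blast
qed

end

theory Submission
  imports Defs
begin

text \<open>
  Let \<open>c\<close> be the circumcenter of \<open>P\<close>, moved to the origin, and let \<open>C\<close> be the set of those points of
  \<open>P\<close> that lie on the circumsphere, the sphere of radius \<open>t = r\<^sub>0\<close> around \<open>c\<close>. If some direction \<open>u\<close>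
  had positive inner product with every point of \<open>C\<close>, then a small shift of the center along \<open>u\<close> would
  decrease the radius; so each \<open>u\<close> satisfies \<open>q \<bullet> u \<le> 0\<close> for some \<open>q \<in> C\<close> (lemma
  \<open>circumcenter_exists\<close>). It remains to bound the volume of \<open>K = (\<Inter>q\<in>C. cball q r)\<close>, which contains a
  translate of the ball body of \<open>P\<close>.

  Decompose the space into the cones \<open>W q\<close> of points that are at least as far from \<open>q\<close> as from any other
  point of \<open>C\<close>. On \<open>W q\<close> the linear form given by \<open>q\<close> is nonpositive, so \<open>W q \<inter> K\<close> lies in the half
  lense \<open>H q = {x. x \<bullet> q \<le> 0 \<and> norm (x - q) \<le> r}\<close>; two opposite half lenses make up the lense of the
  theorem. The heart of the proof is that a closed convex cone \<open>W\<close> in the half-space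
  \<open>{x. x \<bullet> q \<le> 0}\<close> that contains the axis direction \<open>-q\<close> takes up at most as large a fraction of the
  half lense \<open>H q\<close> as of the unit half ball (lemma \<open>measure_convex_cone_Int_half_lense\<close>). Indeed the
  half lense is wider than a ball near the equator and flatter near the pole, while the fraction of
  directions in \<open>W\<close> at a given angle from the axis decreases with that angle, since \<open>W\<close> is starshaped
  about its axis. Summed over the cones, which tile the unit ball \<open>B\<close>, this gives
  \<open>vol K \<le> vol H / vol (half ball) * vol B = 2 * vol H = vol L\<close>.

  The fraction inequality is proved without spherical coordinates. Replace the unit half ball by a
  half ball \<open>B\<^sub>R\<close> of the same volume as \<open>H\<close>. The points common to the two boundary spheres lie in a plane
  orthogonal to the axis, so some round cone about the axis separates \<open>H - B\<^sub>R\<close>, which is outside it, from \<open>B\<^sub>R - H\<close>,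
  which is inside. Let \<open>V\<close> be the set of points whose azimuth about the axis is one for which the
  generating ray of that round cone belongs to \<open>W\<close>. Then \<open>W\<close> contains \<open>V\<close> inside the round cone and is
  contained in \<open>V\<close> outside it, whereas the azimuth is independent of the distances along and from the
  axis, so that \<open>V\<close> has equal volume in \<open>H - B\<^sub>R\<close> and in \<open>B\<^sub>R - H\<close> (lemma
  \<open>measure_convex_cone_outer_le_inner\<close>).
\<close>

section \<open>Lebesgue measure under orthogonal transformations\<close>

text \<open>Uniqueness of Haar measure on a Euclidean space: evaluate the double integral of
  \<open>indicator A x * indicator B (x + y)\<close> against \<open>\<mu>\<close> in \<open>x\<close> and Lebesgue measure in \<open>y\<close> in both orders.\<close>

lemma translation_invariant_measure_proportional_lborel:
  fixes \<mu> :: "'a::euclidean_space measure"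
  assumes "sigma_finite_measure \<mu>" and sets [simp, measurable_cong]: "sets \<mu> = sets borel"
    and transl: "\<And>t. distr \<mu> borel (\<lambda>x. x + t) = \<mu>"
    and A [measurable]: "A \<in> sets borel" and B [measurable]: "B \<in> sets borel"
  shows "emeasure lborel B * emeasure \<mu> A = emeasure lborel A * emeasure \<mu> B"
proof -
  interpret sigma_finite_measure \<mu> by fact
  interpret pair_sigma_finite lborel \<mu> ..
  have in_\<mu> [measurable]: "A \<in> sets \<mu>" "B \<in> sets \<mu>" by simp_all
  have shift: "(\<integral>\<^sup>+y. indicator B (x + y) \<partial>lborel) = emeasure lborel B" for x :: 'a
  proof -
    have "emeasure lborel B = emeasure (distr lborel borel (\<lambda>y. x + y)) B"
      using lborel_affine[of 1 x] by (simp add: density_1)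
    also have "\<dots> = (\<integral>\<^sup>+y. indicator B y \<partial>distr lborel borel (\<lambda>y. x + y))" by simp
    also have "\<dots> = (\<integral>\<^sup>+y. indicator B (x + y) \<partial>lborel)"
      by (subst nn_integral_distr) auto
    finally show ?thesis by simp
  qed
  have reflect: "(\<integral>\<^sup>+y. indicator A (x - y) \<partial>lborel) = emeasure lborel A" for x :: 'a
  proof -
    have "emeasure lborel A = emeasure (distr lborel borel (\<lambda>y. x - y)) A"
      using lborel_affine[of "-1" x] by (simp add: density_1)
    also have "\<dots> = (\<integral>\<^sup>+y. indicator A y \<partial>distr lborel borel (\<lambda>y. x - y))" by simp
    also have "\<dots> = (\<integral>\<^sup>+y. indicator A (x - y) \<partial>lborel)"
      by (subst nn_integral_distr) auto
    finally show ?thesis by simp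
  qed
  have "emeasure lborel B * emeasure \<mu> A
      = (\<integral>\<^sup>+x. indicator A x * (\<integral>\<^sup>+y. indicator B (x + y) \<partial>lborel) \<partial>\<mu>)"
    by (simp add: shift nn_integral_multc mult.commute)
  also have "\<dots> = (\<integral>\<^sup>+x. (\<integral>\<^sup>+y. indicator A x * indicator B (x + y) \<partial>lborel) \<partial>\<mu>)"
    by (simp add: nn_integral_cmult)
  also have "\<dots> = (\<integral>\<^sup>+y. (\<integral>\<^sup>+x. indicator A x * indicator B (x + y) \<partial>\<mu>) \<partial>lborel)"
    by (rule Fubini') measurable
  also have "\<dots> = (\<integral>\<^sup>+y. (\<integral>\<^sup>+x. indicator A (x - y) * indicator B x \<partial>\<mu>) \<partial>lborel)"
  proof (rule nn_integral_cong)
    fix y :: 'a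
    have "(\<integral>\<^sup>+x. indicator A (x - y) * indicator B x \<partial>\<mu>)
        = (\<integral>\<^sup>+x. indicator A (x - y) * indicator B x \<partial>distr \<mu> borel (\<lambda>x. x + y))"
      by (simp add: transl)
    also have "\<dots> = (\<integral>\<^sup>+x. indicator A x * indicator B (x + y) \<partial>\<mu>)"
      by (subst nn_integral_distr) auto
    finally show "(\<integral>\<^sup>+x. indicator A x * indicator B (x + y) \<partial>\<mu>)
        = (\<integral>\<^sup>+x. indicator A (x - y) * indicator B x \<partial>\<mu>)" ..
  qed
  also have "\<dots> = (\<integral>\<^sup>+x. (\<integral>\<^sup>+y. indicator A (x - y) * indicator B x \<partial>lborel) \<partial>\<mu>)"
    by (rule Fubini'[symmetric]) measurable
  also have "\<dots> = (\<integral>\<^sup>+x. indicator B x * emeasure lborel A \<partial>\<mu>)"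
    by (simp add: nn_integral_multc reflect mult.commute[of _ "indicator B _"] nn_integral_cmult)
  also have "\<dots> = emeasure lborel A * emeasure \<mu> B"
    by (simp add: nn_integral_multc mult.commute)
  finally show ?thesis .
qed

text \<open>The image of Lebesgue measure is translation invariant, hence a multiple of Lebesgue measure, and
  the unit ball shows that the factor is 1.\<close>

lemma orthogonal_transformation_measure_lborel:
  fixes f :: "'a::euclidean_space \<Rightarrow> 'a"
  assumes f: "orthogonal_transformation f" and A [measurable]: "A \<in> sets borel"
  shows "measure lborel (f -` A) = measure lborel A"
proof -
  have lin: "linear f" and iso: "\<And>x. norm (f x) = norm x"
    using f by (auto simp: orthogonal_transformation)
  have [measurable]: "f \<in> borel_measurable borel"
    using lin by (intro borel_measurable_continuous_onI linear_continuous_on linear_conv_bounded_linear[THEN iffD1])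
  have pre_ball: "f -` cball 0 \<rho> = cball 0 \<rho>" for \<rho>
    using iso by auto
  define \<mu> where "\<mu> = distr lborel borel f"
  have sets [simp]: "sets \<mu> = sets borel" by (simp add: \<mu>_def)
  have em: "emeasure \<mu> X = emeasure lborel (f -` X)" if "X \<in> sets borel" for X
    using that by (simp add: \<mu>_def emeasure_distr)
  have ball_pos: "0 < emeasure lborel (cball (0::'a) 1)"
    using content_cball_pos[of 1 "0::'a"] by (simp add: measure_def enn2real_positive_iff)
  have sf: "sigma_finite_measure \<mu>"
  proof
    show "\<exists>A. countable A \<and> A \<subseteq> sets \<mu> \<and> \<Union> A = space \<mu> \<and> (\<forall>a\<in>A. emeasure \<mu> a \<noteq> \<infinity>)"
      by (intro exI[of _ "range (\<lambda>n::nat. cball 0 (real n))"])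
         (use emeasure_lborel_cball_finite[of "0::'a"] real_arch_simple in
           \<open>auto simp: \<mu>_def emeasure_distr pre_ball top.not_eq_extremum\<close>)
  qed
  have transl: "distr \<mu> borel (\<lambda>x. x + t) = \<mu>" for t
  proof -
    obtain u where u: "f u = t"
      using orthogonal_transformation_surj[OF f] by (metis surjD)
    have "distr \<mu> borel (\<lambda>x. x + t) = distr lborel borel (\<lambda>x. f x + t)"
      unfolding \<mu>_def by (subst distr_distr) (auto simp: o_def)
    also have "\<dots> = distr lborel borel (\<lambda>x. f (u + x))"
      using linear_add[OF lin] u by (simp add: add.commute)
    also have "\<dots> = distr (distr lborel borel (\<lambda>x. u + x)) borel f"
      by (subst distr_distr) (auto simp: o_def)
    also have "distr lborel borel (\<lambda>x. u + x) = lborel"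
      using lborel_affine[of 1 u] by (simp add: density_1)
    finally show ?thesis by (simp add: \<mu>_def)
  qed
  have "emeasure lborel (cball (0::'a) 1) * emeasure \<mu> A = emeasure lborel A * emeasure \<mu> (cball 0 1)"
    by (rule translation_invariant_measure_proportional_lborel[OF sf sets transl]) auto
  also have "\<dots> = emeasure lborel (cball (0::'a) 1) * emeasure lborel A"
    by (simp add: em pre_ball mult.commute)
  finally have "emeasure \<mu> A = emeasure lborel A"
    using ball_pos emeasure_lborel_cball_finite[of "0::'a" 1]
    by (auto simp: ennreal_mult_cancel_left)
  then show ?thesis by (simp add: em measure_def)
qed

section \<open>Azimuth and axial coordinates are independent\<close>

definition perp :: "'a::euclidean_space \<Rightarrow> 'a \<Rightarrow> 'a" where
  "perp e x = x - (x \<bullet> e) *\<^sub>R e"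

lemma borel_measurable_perp [measurable]: "perp e \<in> borel_measurable borel"
  unfolding perp_def by measurable

lemma emeasure_axial_scaling:
  fixes e :: "'a::euclidean_space"
  assumes e: "e \<in> Basis" and pos: "\<alpha> > 0" "\<beta> > 0" and A [measurable]: "A \<in> sets borel"
  shows "emeasure lborel A
    = ennreal (\<alpha> * \<beta> ^ (DIM('a) - 1)) * emeasure lborel {x. (t + \<alpha> * (x \<bullet> e)) *\<^sub>R e + \<beta> *\<^sub>R perp e x \<in> A}"
proof -
  define c where "c j = (if j = e then \<alpha> else \<beta>)" for j
  define T where "T x = t *\<^sub>R e + (\<Sum>j\<in>Basis. (c j * (x \<bullet> j)) *\<^sub>R j)" for x :: 'a
  have T: "T x = (t + \<alpha> * (x \<bullet> e)) *\<^sub>R e + \<beta> *\<^sub>R perp e x" for x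
  proof -
    have "(\<Sum>j\<in>Basis. (c j * (x \<bullet> j)) *\<^sub>R j)
        = (\<Sum>j\<in>Basis. \<beta> *\<^sub>R (x \<bullet> j) *\<^sub>R j + (if j = e then ((\<alpha> - \<beta>) * (x \<bullet> e)) *\<^sub>R e else 0))"
      by (rule sum.cong) (auto simp: c_def algebra_simps)
    also have "\<dots> = \<beta> *\<^sub>R x + ((\<alpha> - \<beta>) * (x \<bullet> e)) *\<^sub>R e"
      using e by (simp add: sum.distrib scaleR_sum_right[symmetric] euclidean_representation del: scaleR_scaleR)
    finally show ?thesis
      by (simp add: T_def perp_def algebra_simps)
  qed
  have [measurable]: "T \<in> borel_measurable borel"
    unfolding T by measurable
  have "(\<Prod>j\<in>Basis. \<bar>c j\<bar>) = \<alpha> * (\<Prod>j\<in>Basis - {e}. \<bar>c j\<bar>)"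
    using e pos by (subst prod.remove[of _ e]) (auto simp: c_def)
  also have "(\<Prod>j\<in>Basis - {e}. \<bar>c j\<bar>) = (\<Prod>j\<in>Basis - {e}. \<beta>)"
    using pos by (intro prod.cong) (auto simp: c_def)
  finally have det: "(\<Prod>j\<in>Basis. \<bar>c j\<bar>) = \<alpha> * \<beta> ^ (DIM('a) - 1)"
    using e by (simp add: prod_constant card_Diff_singleton)
  have "lborel = density (distr lborel borel T) (\<lambda>_. ennreal (\<Prod>j\<in>Basis. \<bar>c j\<bar>))"
    using lborel_affine_euclidean[of c "t *\<^sub>R e"] pos unfolding T_def by (auto simp: c_def)
  then have "emeasure lborel A = emeasure (density (distr lborel borel T) (\<lambda>_. ennreal (\<Prod>j\<in>Basis. \<bar>c j\<bar>))) A"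
    by simp
  also have "\<dots> = ennreal (\<alpha> * \<beta> ^ (DIM('a) - 1)) * emeasure lborel (T -` A)"
    by (simp add: emeasure_density nn_integral_cmult_indicator emeasure_distr det)
  finally show ?thesis
    by (simp add: vimage_def T)
qed

text \<open>Membership depends only on the direction of \<open>perp e x\<close>, the azimuth of \<open>x\<close> about the axis \<open>e\<close>.
  The maps in the definition are those of \<open>emeasure_axial_scaling\<close>.\<close>

definition azimuthal :: "'a::euclidean_space \<Rightarrow> 'a set \<Rightarrow> bool" where
  "azimuthal e V \<longleftrightarrow> (\<forall>x t \<alpha> \<beta>. \<alpha> > 0 \<longrightarrow> \<beta> > 0 \<longrightarrow>
    ((t + \<alpha> * (x \<bullet> e)) *\<^sub>R e + \<beta> *\<^sub>R perp e x \<in> V \<longleftrightarrow> x \<in> V))"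

lemma azimuthal_UNIV [simp]: "azimuthal e UNIV"
  by (simp add: azimuthal_def)

definition axial_cylinder :: "'a::euclidean_space \<Rightarrow> real \<Rightarrow> real \<Rightarrow> real \<Rightarrow> 'a set" where
  "axial_cylinder e a b R = {x. a < x \<bullet> e \<and> x \<bullet> e < b \<and> norm (perp e x) < R}"

lemma axial_cylinder_borel [measurable]: "axial_cylinder e a b R \<in> sets borel"
  unfolding axial_cylinder_def by measurable

lemma norm_axial_decomp:
  assumes "norm e = 1"
  shows "(norm x)\<^sup>2 = (x \<bullet> e)\<^sup>2 + (norm (perp e x))\<^sup>2"
  using assms unfolding perp_def power2_norm_eq_inner norm_eq_1
  by (simp add: inner_diff_left inner_diff_right inner_commute power2_eq_square)

lemma perp_add_axis: "norm e = 1 \<Longrightarrow> perp e (c *\<^sub>R e + x) = perp e x"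
  by (simp add: perp_def inner_add_left norm_eq_1 algebra_simps)

lemma perp_scale: "perp e (c *\<^sub>R x) = c *\<^sub>R perp e x"
  by (simp add: perp_def algebra_simps)

lemma inner_perp [simp]: "norm e = 1 \<Longrightarrow> perp e x \<bullet> e = 0"
  by (simp add: perp_def inner_diff_left norm_eq_1)

lemma perp_perp: "norm e = 1 \<Longrightarrow> perp e (perp e x) = perp e x"
  by (simp add: perp_def[of _ "perp e x"])

lemma emeasure_axial_cylinder_finite:
  assumes "norm e = 1"
  shows "emeasure lborel (axial_cylinder e a b R) < \<infinity>"
proof (rule emeasure_bounded_finite, rule boundedI)
  fix x assume x: "x \<in> axial_cylinder e a b R"
  have "norm x \<le> norm ((x \<bullet> e) *\<^sub>R e) + norm (perp e x)"
    using norm_triangle_ineq[of "(x \<bullet> e) *\<^sub>R e" "perp e x"] by (simp add: perp_def)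
  then show "norm x \<le> \<bar>a\<bar> + \<bar>b\<bar> + R"
    using x assms by (auto simp: axial_cylinder_def)
qed

lemma measure_axial_cylinder_pos:
  fixes e :: "'a::euclidean_space"
  assumes "norm e = 1"
  shows "0 < measure lborel (axial_cylinder e 0 1 1)"
proof -
  have "continuous_on UNIV (perp e)"
    unfolding perp_def by (intro continuous_intros)
  then have "open (axial_cylinder e 0 1 1)"
    unfolding axial_cylinder_def
    by (intro open_Collect_conj open_Collect_less continuous_intros) auto
  moreover have "(1/2) *\<^sub>R e \<in> axial_cylinder e 0 1 1"
    using assms by (auto simp: axial_cylinder_def perp_def norm_eq_1)
  ultimately obtain \<rho> where \<rho>: "\<rho> > 0" "cball ((1/2) *\<^sub>R e) \<rho> \<subseteq> axial_cylinder e 0 1 1"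
    using open_contains_cball by blast
  have "0 < measure lborel (cball ((1/2) *\<^sub>R e) \<rho>)"
    using content_cball_pos[OF \<rho>(1), of "(1/2) *\<^sub>R e"] by simp
  also have "\<dots> \<le> measure lborel (axial_cylinder e 0 1 1)"
    using \<rho> emeasure_axial_cylinder_finite[OF assms]
    by (intro measure_mono_fmeasurable) (auto simp: fmeasurable_def)
  finally show ?thesis .
qed

text \<open>The affine map of \<open>emeasure_axial_scaling\<close> carries the unit cylinder to any other cylinder and
  preserves \<open>V\<close>.\<close>

lemma measure_azimuthal_cylinder:
  fixes e :: "'a::euclidean_space"
  assumes e: "e \<in> Basis" and V [measurable]: "V \<in> sets borel"
    and az: "azimuthal e V"
    and "a < b" "R > 0"
  shows "measure lborel (V \<inter> axial_cylinder e a b R)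
    = (b - a) * R ^ (DIM('a) - 1) * measure lborel (V \<inter> axial_cylinder e 0 1 1)"
proof -
  have e1: "norm e = 1" "e \<bullet> e = 1" using e by (auto simp: norm_eq_1[symmetric])
  have unit: "a + (b - a) * u < b \<longleftrightarrow> u < 1" for u
  proof -
    have "(b - a) * u < (b - a) * 1 \<longleftrightarrow> u < 1"
      using \<open>a < b\<close> by (intro mult_less_cancel_left_pos) simp
    then show ?thesis by (simp add: algebra_simps)
  qed
  have "{x. (a + (b - a) * (x \<bullet> e)) *\<^sub>R e + R *\<^sub>R perp e x \<in> V \<inter> axial_cylinder e a b R}
      = V \<inter> axial_cylinder e 0 1 1"
    using az[unfolded azimuthal_def, rule_format, of "b - a" R a] assms e1
    by (auto simp: axial_cylinder_def inner_add_left perp_add_axis perp_scale perp_perp zero_less_mult_iff unit)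
  then have "emeasure lborel (V \<inter> axial_cylinder e a b R)
      = ennreal ((b - a) * R ^ (DIM('a) - 1)) * emeasure lborel (V \<inter> axial_cylinder e 0 1 1)"
    using emeasure_axial_scaling[OF e, of "b - a" R "V \<inter> axial_cylinder e a b R" a] assms by simp
  then show ?thesis
    using assms by (simp add: measure_def enn2real_mult)
qed

definition axial_coords :: "'a::euclidean_space \<Rightarrow> 'a \<Rightarrow> real \<times> real" where
  "axial_coords e x = (x \<bullet> e, norm (perp e x))"

lemma borel_measurable_axial_coords [measurable]: "axial_coords e \<in> borel_measurable borel"
  unfolding axial_coords_def by measurable

lemma fmeasurable_subset_axial_cylinder:
  assumes "norm e = 1" "V \<in> sets borel" "V \<subseteq> axial_cylinder e a b R"
  shows "V \<in> fmeasurable lborel"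
  using assms emeasure_axial_cylinder_finite[of e a b R] emeasure_mono[of V "axial_cylinder e a b R" lborel]
  by (auto simp: fmeasurable_def le_less_trans)

text \<open>The lateral surface is negligible: squeeze the closed cylinder between open ones. For \<open>R = 0\<close> the
  cylinder degenerates to a segment of the axis, and it is here that the dimension must exceed 1.\<close>

lemma measure_azimuthal_closed_cylinder:
  fixes e :: "'a::euclidean_space"
  assumes e: "e \<in> Basis" and V [measurable]: "V \<in> sets borel"
    and az: "azimuthal e V"
    and dim: "DIM('a) > 1" and "a < b" "R \<ge> 0"
  shows "measure lborel (V \<inter> {x. a < x \<bullet> e \<and> x \<bullet> e < b \<and> norm (perp e x) \<le> R})
    = (b - a) * R ^ (DIM('a) - 1) * measure lborel (V \<inter> axial_cylinder e 0 1 1)" (is "?m = ?f R")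
proof (rule antisym)
  let ?C = "{x. a < x \<bullet> e \<and> x \<bullet> e < b \<and> norm (perp e x) \<le> R}"
  have e1: "norm e = 1" using e by auto
  have C: "V \<inter> ?C \<in> fmeasurable lborel"
    by (rule fmeasurable_subset_axial_cylinder[OF e1, of _ a b "R + 1"]) (auto simp: axial_cylinder_def)
  have fm: "V \<inter> axial_cylinder e a b S \<in> fmeasurable lborel" for S
    by (rule fmeasurable_subset_axial_cylinder[OF e1]) auto
  have upper: "?m \<le> ?f S" if "S > R" for S
  proof -
    have "?m \<le> measure lborel (V \<inter> axial_cylinder e a b S)"
      using that C fm by (intro measure_mono_fmeasurable) (auto simp: axial_cylinder_def fmeasurable_def)
    then show ?thesis
      using measure_azimuthal_cylinder[OF e V az \<open>a < b\<close>, of S] that \<open>R \<ge> 0\<close> by simp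
  qed
  show "?m \<le> ?f R"
  proof (rule tendsto_lowerbound)
    show "(?f \<longlongrightarrow> ?f R) (at_right R)"
      by (intro tendsto_intros)
    show "\<forall>\<^sub>F S in at_right R. ?m \<le> ?f S"
      using upper by (auto simp: eventually_at_filter)
  qed simp
  show "?f R \<le> ?m"
  proof (cases "R = 0")
    case True
    then show ?thesis using dim by (simp add: power_0_left)
  next
    case False
    then have "?f R = measure lborel (V \<inter> axial_cylinder e a b R)"
      using measure_azimuthal_cylinder[OF e V az \<open>a < b\<close>, of R] \<open>R \<ge> 0\<close> by simp
    also have "\<dots> \<le> ?m"
      using C fm by (intro measure_mono_fmeasurable) (auto simp: axial_cylinder_def fmeasurable_def)
    finally show ?thesis .
  qed
qed

text \<open>A box in the axial coordinates is a cylindrical shell. The cut-off at 0 covers boxes with a negative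
  lower radius, on which the inner cylinder is empty.\<close>

lemma measure_azimuthal_box:
  fixes e :: "'a::euclidean_space"
  assumes e: "e \<in> Basis" and V [measurable]: "V \<in> sets borel"
    and az: "azimuthal e V"
    and dim: "DIM('a) > 1" and "a < b" "c < d"
  shows "measure lborel (V \<inter> axial_coords e -` box (a, c) (b, d))
    = (b - a) * (max 0 d ^ (DIM('a) - 1) - max 0 c ^ (DIM('a) - 1)) * measure lborel (V \<inter> axial_cylinder e 0 1 1)"
proof -
  let ?C = "{x. a < x \<bullet> e \<and> x \<bullet> e < b \<and> norm (perp e x) \<le> c}"
  have e1: "norm e = 1" using e by auto
  have fm: "V \<inter> axial_cylinder e a b d \<in> fmeasurable lborel"
    by (rule fmeasurable_subset_axial_cylinder[OF e1]) auto
  have box: "axial_coords e -` box (a, c) (b, d) = axial_cylinder e a b d - ?C"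
    by (auto simp: axial_coords_def axial_cylinder_def mem_box Basis_prod_def)
  have "V \<inter> axial_coords e -` box (a, c) (b, d) = (V \<inter> axial_cylinder e a b d) - (V \<inter> ?C)"
    unfolding box by blast
  also have "measure lborel \<dots> = measure lborel (V \<inter> axial_cylinder e a b d) - measure lborel (V \<inter> ?C)"
    using fm \<open>c < d\<close> by (intro measure_Diff) (auto simp: axial_cylinder_def fmeasurable_def top.not_eq_extremum)
  also have "measure lborel (V \<inter> axial_cylinder e a b d)
      = (b - a) * max 0 d ^ (DIM('a) - 1) * measure lborel (V \<inter> axial_cylinder e 0 1 1)"
  proof (cases "d > 0")
    case True
    then show ?thesis using measure_azimuthal_cylinder[OF e V az \<open>a < b\<close> True] by simp
  next
    case False
    then have "axial_cylinder e a b d = {}"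
      by (auto simp: axial_cylinder_def not_less order_trans[OF _ norm_ge_zero])
    then show ?thesis using False dim by (simp add: max_def power_0_left)
  qed
  also have "measure lborel (V \<inter> ?C)
      = (b - a) * max 0 c ^ (DIM('a) - 1) * measure lborel (V \<inter> axial_cylinder e 0 1 1)"
  proof (cases "c \<ge> 0")
    case True
    then show ?thesis using measure_azimuthal_closed_cylinder[OF e V az dim \<open>a < b\<close> True] by simp
  next
    case False
    then have "?C = {}"
      by (auto simp: not_le less_le_trans[OF _ norm_ge_zero])
    then show ?thesis using False dim by (simp only: Int_empty_right) (simp add: max_def power_0_left)
  qed
  finally show ?thesis by (simp add: algebra_simps)
qed

text \<open>Conditioning on \<open>V\<close> does not change the distribution of the axial coordinates: on boxes, which form a
  generator of the Borel sets that is closed under intersection, the volume inside \<open>V\<close> is a quantity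
  independent of \<open>V\<close> times the volume of \<open>V\<close> in the unit cylinder. The statement is multiplied out with
  the two volumes in the unit cylinder.\<close>

lemma azimuthal_independent_of_axial_coords:
  fixes e :: "'a::euclidean_space"
  assumes e: "e \<in> Basis" and V [measurable]: "V \<in> sets borel"
    and az: "azimuthal e V"
    and dim: "DIM('a) > 1" and S [measurable]: "S \<in> sets borel"
  shows "measure lborel (axial_cylinder e 0 1 1) * measure lborel (V \<inter> axial_coords e -` S)
    = measure lborel (V \<inter> axial_cylinder e 0 1 1) * measure lborel (axial_coords e -` S)"
proof -
  have e1: "norm e = 1" using e by auto
  define k where "k U = measure lborel (U \<inter> axial_cylinder e 0 1 1)" for U
  define D where "D U = distr (density lborel (indicator U)) borel (axial_coords e)" for U
  define M where "M = scale_measure (ennreal (k UNIV)) (D V)"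
  define N where "N = scale_measure (ennreal (k V)) (D UNIV)"
  have D: "emeasure (D U) X = emeasure lborel (U \<inter> axial_coords e -` X)"
    if [measurable]: "U \<in> sets borel" "X \<in> sets borel" for U X
  proof -
    have [measurable]: "axial_coords e -` X \<in> sets borel"
      using measurable_sets[OF borel_measurable_axial_coords that(2), of e] by simp
    show ?thesis
      unfolding D_def by (simp add: emeasure_distr emeasure_density indicator_inter_arith[symmetric])
  qed
  have box: "emeasure lborel (U \<inter> axial_coords e -` box (a, c) (b, d)) = ennreal
      ((b - a) * (max 0 d ^ (DIM('a) - 1) - max 0 c ^ (DIM('a) - 1)) * k U)"
    if [measurable]: "U \<in> sets borel" and "a < b" "c < d"
      and "azimuthal e U"
    for U a b c d
  proof -
    have "U \<inter> axial_coords e -` box (a, c) (b, d) \<in> fmeasurable lborel"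
    proof (rule fmeasurable_subset_axial_cylinder[OF e1])
      have "axial_coords e -` box (a, c) (b, d) \<in> sets borel"
        using measurable_sets[OF borel_measurable_axial_coords, of "box (a, c) (b, d)" e] by simp
      then show "U \<inter> axial_coords e -` box (a, c) (b, d) \<in> sets borel" by simp
      show "U \<inter> axial_coords e -` box (a, c) (b, d) \<subseteq> axial_cylinder e a b d"
        by (auto simp: axial_coords_def axial_cylinder_def mem_box Basis_prod_def)
    qed
    then show ?thesis
      using measure_azimuthal_box[OF e that(1,4) dim that(2,3)]
      by (simp add: emeasure_eq_measure2 k_def)
  qed
  have mono: "max 0 c ^ n \<le> max 0 d ^ n" if "c < d" for c d :: real and n
    using that by (intro power_mono) auto
  have k0: "k U \<ge> 0" for U by (simp add: k_def)
  have eq: "emeasure M X = emeasure N X" if X_box: "X \<in> range (\<lambda>(p, q). box p q)" for X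
  proof -
    obtain a b c d where X: "X = box (a, c) (b, d)"
      using X_box by auto
    show ?thesis
    proof (cases "a < b \<and> c < d")
      case True
      then show ?thesis
        using box[of V a b c d] box[of UNIV a b c d] az mono[of c d] k0
        by (simp add: M_def N_def D X ennreal_mult[symmetric] mult_ac)
    next
      case False
      then have "X = {}"
        by (auto simp: X box_eq_empty Basis_prod_def)
      then show ?thesis by simp
    qed
  qed
  have "M = N"
  proof (rule measure_eqI_generator_eq[where E = "range (\<lambda>(p, q). box p q)" and \<Omega> = UNIV
        and A = "\<lambda>n::nat. box (- (real n *\<^sub>R One)) (real n *\<^sub>R One)"])
    show "Int_stable (range (\<lambda>(p, q). box p q :: (real \<times> real) set))"
      by (auto simp: Int_stable_def box_Int_box)
    show "sets M = sigma_sets UNIV (range (\<lambda>(p, q). box p q))"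
      "sets N = sigma_sets UNIV (range (\<lambda>(p, q). box p q))"
      by (simp_all add: borel_eq_box M_def N_def D_def)
    show "range (\<lambda>n::nat. box (- (real n *\<^sub>R One)) (real n *\<^sub>R One) :: (real \<times> real) set)
        \<subseteq> range (\<lambda>(p, q). box p q)"
      "(\<Union>n::nat. box (- (real n *\<^sub>R One)) (real n *\<^sub>R One)) = (UNIV :: (real \<times> real) set)"
      unfolding UN_box_eq_UNIV by auto
    show "emeasure M (box (- (real n *\<^sub>R One)) (real n *\<^sub>R One)) \<noteq> \<infinity>" for n
    proof (cases n)
      case 0
      have "box (- (real n *\<^sub>R One)) (real n *\<^sub>R One) = ({} :: (real \<times> real) set)"
        using 0 by (simp add: box_eq_empty)
      then show ?thesis by simp
    next
      case (Suc m)
      have "(One :: real \<times> real) = (1, 1)"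
        by (simp add: Basis_prod_def sum.union_disjoint image_iff zero_prod_def)
      then show ?thesis
        using box[of V "- real n" "real n" "- real n" "real n"] az Suc k0 mono[of "- real n" "real n"]
        by (simp add: M_def D ennreal_mult_eq_top_iff)
    qed
  qed (use eq in auto)
  then have "emeasure M S = emeasure N S" by simp
  then have "ennreal (k UNIV) * emeasure lborel (V \<inter> axial_coords e -` S)
      = ennreal (k V) * emeasure lborel (axial_coords e -` S)"
    by (simp add: M_def N_def D)
  then have "enn2real (ennreal (k UNIV) * emeasure lborel (V \<inter> axial_coords e -` S))
      = enn2real (ennreal (k V) * emeasure lborel (axial_coords e -` S))"
    by simp
  then show ?thesis
    using k0 by (simp add: enn2real_mult measure_def k_def)
qed

section \<open>A convex cone in a half lense and in a half ball\<close>

lemma fmeasurable_lborel_bounded: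
  fixes A :: "'a::euclidean_space set"
  shows "A \<in> sets borel \<Longrightarrow> bounded A \<Longrightarrow> A \<in> fmeasurable lborel"
  using emeasure_bounded_finite[of A] by (simp add: fmeasurable_def)

lemma measure_scale_conic_Int_cball:
  fixes W :: "'a::euclidean_space set"
  assumes "conic W" and W [measurable]: "W \<in> sets borel" and "\<rho> > 0"
  shows "measure lborel (W \<inter> cball 0 \<rho>) = \<rho> ^ DIM('a) * measure lborel (W \<inter> cball 0 1)"
proof -
  have "W \<inter> cball 0 \<rho> = (\<lambda>x. \<rho> *\<^sub>R x + 0) ` (W \<inter> cball 0 1)"
  proof safe
    fix x assume "x \<in> W" "x \<in> cball 0 \<rho>"
    then have "x /\<^sub>R \<rho> \<in> W \<inter> cball 0 1"
      using assms conic_mul[of W x "inverse \<rho>"] by (auto simp: field_simps)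
    then show "x \<in> (\<lambda>x. \<rho> *\<^sub>R x + 0) ` (W \<inter> cball 0 1)"
      using \<open>\<rho> > 0\<close> by (intro image_eqI[of _ _ "x /\<^sub>R \<rho>"]) auto
  next
    fix x assume "x \<in> W" "x \<in> cball 0 1"
    then show "\<rho> *\<^sub>R x + 0 \<in> W" "\<rho> *\<^sub>R x + 0 \<in> cball 0 \<rho>"
      using assms conic_mul[of W x \<rho>] by auto
  qed
  then have "measure lebesgue (W \<inter> cball 0 \<rho>) = \<rho> ^ DIM('a) * measure lebesgue (W \<inter> cball 0 1)"
    using measure_lebesgue_affine[of \<rho> 0 "W \<inter> cball 0 1"] \<open>\<rho> > 0\<close> by simp
  then show ?thesis by simp
qed

lemma measure_diff_eq_difference:
  assumes "A \<in> fmeasurable M" "B \<in> fmeasurable M"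
  shows "measure M A - measure M B = measure M (A - B) - measure M (B - A)"
proof -
  have "measure M (A - B) = measure M A - measure M (A \<inter> B)" "measure M (B - A) = measure M B - measure M (A \<inter> B)"
    using measurable_measure_Diff[of A M "A \<inter> B"] measurable_measure_Diff[of B M "A \<inter> B"] assms
    by (auto simp: Diff_Int fmeasurableD)
  then show ?thesis by simp
qed

lemma convex_cone_scaleR_iff:
  assumes "convex_cone W" "c > 0"
  shows "c *\<^sub>R x \<in> W \<longleftrightarrow> x \<in> W"
  using convex_cone_scaleR[OF assms(1), of c x] convex_cone_scaleR[OF assms(1), of "inverse c" "c *\<^sub>R x"] assms(2)
  by auto

text \<open>The two sets of revolution have the same volume and are separated by the round cone
  \<open>k * s = c * \<rho>\<close>, where \<open>s\<close> and \<open>\<rho>\<close> are the distances along and from the axis. Compare \<open>W\<close> with the set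
  \<open>V\<close> of all points whose azimuth is that of a generating ray of the round cone contained in \<open>W\<close>. By
  independence \<open>V\<close> does not distinguish the two sets. Adding a nonnegative multiple of the axis vector \<open>e\<close>
  moves a point of \<open>W\<close> inward within \<open>W\<close>, so \<open>W\<close> lies in \<open>V\<close> on the outer set and contains \<open>V\<close> on the inner set.\<close>

lemma measure_convex_cone_outer_le_inner:
  fixes e :: "'a::euclidean_space"
  assumes e: "e \<in> Basis" and dim: "DIM('a) > 1"
    and W: "closed W" "convex_cone W" "e \<in> W"
    and S [measurable]: "S \<in> sets borel" and T [measurable]: "T \<in> sets borel"
    and c: "k \<ge> 0" "c + k > 0"
    and outer: "\<And>s \<rho>. (s, \<rho>) \<in> S \<Longrightarrow> 0 \<le> \<rho> \<Longrightarrow> k * s \<le> c * \<rho>"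
    and inner: "\<And>s \<rho>. (s, \<rho>) \<in> T \<Longrightarrow> 0 \<le> \<rho> \<Longrightarrow> 0 \<le> s \<and> c * \<rho> \<le> k * s"
    and eq: "measure lborel (axial_coords e -` S) = measure lborel (axial_coords e -` T)"
    and fin: "bounded (axial_coords e -` S)" "bounded (axial_coords e -` T)"
  shows "measure lborel (W \<inter> axial_coords e -` S) \<le> measure lborel (W \<inter> axial_coords e -` T)"
proof -
  have e1: "norm e = 1" "e \<bullet> e = 1" using e by (auto simp: norm_eq_1[symmetric])
  let ?X = "axial_coords e -` S" and ?Y = "axial_coords e -` T"
  let ?v = "\<lambda>x. (c * norm (perp e x)) *\<^sub>R e + k *\<^sub>R perp e x"
  define V where "V = {x. ?v x \<in> W}"
  have [measurable]: "W \<in> sets borel" using W by (simp add: borel_closed)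
  have Vm [measurable]: "V \<in> sets borel"
    unfolding V_def by measurable
  have pre [measurable]: "axial_coords e -` U \<in> sets borel" if "U \<in> sets borel" for U
    using measurable_sets[OF borel_measurable_axial_coords that, of e] by simp
  have decomp: "x = (x \<bullet> e) *\<^sub>R e + perp e x" for x
    by (simp add: perp_def)
  have az: "azimuthal e V"
    unfolding azimuthal_def
  proof (intro allI impI)
    fix x t and \<alpha> \<beta> :: real assume that: "\<alpha> > 0" "\<beta> > 0"
    have "?v ((t + \<alpha> * (x \<bullet> e)) *\<^sub>R e + \<beta> *\<^sub>R perp e x) = \<beta> *\<^sub>R ?v x"
      unfolding perp_add_axis[OF e1(1)] perp_scale perp_perp[OF e1(1)]
      using that by (simp add: algebra_simps)
    then show "(t + \<alpha> * (x \<bullet> e)) *\<^sub>R e + \<beta> *\<^sub>R perp e x \<in> V \<longleftrightarrow> x \<in> V"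
      using convex_cone_scaleR_iff[OF W(2) \<open>\<beta> > 0\<close>, of "?v x"] unfolding V_def by simp
  qed
  have WX: "W \<inter> ?X \<subseteq> V"
  proof
    fix x assume "x \<in> W \<inter> ?X"
    then have "x \<in> W" "axial_coords e x \<in> S" by auto
    then have "k * (x \<bullet> e) \<le> c * norm (perp e x)"
      using outer by (simp add: axial_coords_def)
    then have "k *\<^sub>R x + (c * norm (perp e x) - k * (x \<bullet> e)) *\<^sub>R e \<in> W"
      using \<open>x \<in> W\<close> W c by (intro convex_cone_add convex_cone_scaleR) auto
    also have "k *\<^sub>R x + (c * norm (perp e x) - k * (x \<bullet> e)) *\<^sub>R e = ?v x"
      by (subst (1) decomp) (simp add: algebra_simps)
    finally show "x \<in> V" by (simp add: V_def)
  qed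
  have VY: "V \<inter> ?Y \<subseteq> W"
  proof
    fix x assume "x \<in> V \<inter> ?Y"
    then have x: "x \<in> V" "axial_coords e x \<in> T" by auto
    then have le: "0 \<le> x \<bullet> e" "c * norm (perp e x) \<le> k * (x \<bullet> e)"
      using inner by (auto simp: axial_coords_def)
    show "x \<in> W"
    proof (cases "k = 0")
      case True
      then have "perp e x = 0" using le c by (auto simp: mult_le_0_iff)
      then have "x = (x \<bullet> e) *\<^sub>R e" using decomp[of x] by simp
      then show ?thesis using convex_cone_scaleR[OF W(2) le(1) W(3)] by simp
    next
      case False
      have "?v x + (k * (x \<bullet> e) - c * norm (perp e x)) *\<^sub>R e \<in> W"
        using x(1) le(2)
        by (intro convex_cone_add[OF W(2) _ convex_cone_scaleR[OF W(2) _ W(3)]]) (auto simp: V_def)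
      also have "?v x + (k * (x \<bullet> e) - c * norm (perp e x)) *\<^sub>R e = k *\<^sub>R x"
        by (subst (4) decomp) (simp add: algebra_simps)
      finally show ?thesis using convex_cone_scaleR_iff[OF W(2), of k x] False c by simp
    qed
  qed
  have fm: "U \<inter> ?X \<in> fmeasurable lborel" "U \<inter> ?Y \<in> fmeasurable lborel" if [measurable]: "U \<in> sets borel" for U
    using fin pre[of S] pre[of T] that by (auto intro!: fmeasurable_lborel_bounded bounded_Int)
  have "measure lborel (W \<inter> ?X) \<le> measure lborel (V \<inter> ?X)"
    using WX fm by (intro measure_mono_fmeasurable) auto
  also have "\<dots> = measure lborel (V \<inter> ?Y)"
    using azimuthal_independent_of_axial_coords[OF e Vm az dim S]
      azimuthal_independent_of_axial_coords[OF e Vm az dim T]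
      eq measure_axial_cylinder_pos[OF e1(1)] by (metis mult_left_cancel less_irrefl)
  also have "\<dots> \<le> measure lborel (W \<inter> ?Y)"
    using VY fm by (intro measure_mono_fmeasurable) auto
  finally show ?thesis .
qed

definition half_lense :: "'a::euclidean_space \<Rightarrow> real \<Rightarrow> 'a set" where
  "half_lense q r = {x. x \<bullet> q \<le> 0 \<and> norm (x - q) \<le> r}"

lemma norm_add_axis:
  assumes "norm e = 1"
  shows "(norm (x + t *\<^sub>R e))\<^sup>2 = (x \<bullet> e + t)\<^sup>2 + (norm (perp e x))\<^sup>2"
proof -
  have "perp e (x + t *\<^sub>R e) = perp e x"
    using perp_add_axis[OF assms, of t x] by (simp add: add.commute)
  then show ?thesis
    using norm_axial_decomp[OF assms, of "x + t *\<^sub>R e"] assms by (simp add: inner_add_left norm_eq_1)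
qed

text \<open>Scale the half ball to the volume of the half lense and apply the separation by a round cone to the
  two differences. The inequality between the volumes inside \<open>W\<close> is then scaled back, \<open>W\<close> and the
  half-space \<open>E\<close> both being conic.\<close>

lemma measure_convex_cone_Int_half_lense_axis:
  fixes e :: "'a::euclidean_space"
  assumes e: "e \<in> Basis" and dim: "DIM('a) > 1" and r: "0 < t" "t < r"
    and W: "closed W" "convex_cone W" "e \<in> W" "\<And>x. x \<in> W \<Longrightarrow> x \<bullet> e \<ge> 0"
  shows "measure lborel (W \<inter> half_lense (- (t *\<^sub>R e)) r) * measure lborel ({x. x \<bullet> e \<ge> 0} \<inter> cball 0 1)
    \<le> measure lborel (W \<inter> cball 0 1) * measure lborel (half_lense (- (t *\<^sub>R e)) r)"
proof -
  have e1: "norm e = 1" using e by auto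
  define E where "E = {x. x \<bullet> e \<ge> 0}"
  let ?H = "half_lense (- (t *\<^sub>R e)) r"
  have E: "conic E" "E \<in> sets borel"
    by (auto simp: E_def conic_def)
  have Wm: "W \<in> sets borel" using W by (simp add: borel_closed)
  \<comment> \<open>A ball inside the unit half ball, so that the volume of the latter is positive.\<close>
  have cball_half: "cball ((1/2) *\<^sub>R e) (1/2) \<subseteq> E \<inter> cball 0 1"
  proof
    fix x assume "x \<in> cball ((1/2) *\<^sub>R e) (1/2)"
    then have x: "norm (x - (1/2) *\<^sub>R e) \<le> 1/2" by (simp add: dist_norm norm_minus_commute)
    have "\<bar>(x - (1/2) *\<^sub>R e) \<bullet> e\<bar> \<le> 1/2"
      using Cauchy_Schwarz_ineq2[of "x - (1/2) *\<^sub>R e" e] x e1 by simp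
    then have "x \<bullet> e \<ge> 0"
      using e1 by (simp add: inner_diff_left norm_eq_1 abs_if split: if_splits)
    moreover have "norm x \<le> 1"
      using norm_triangle_ineq[of "x - (1/2) *\<^sub>R e" "(1/2) *\<^sub>R e"] x e1 by simp
    ultimately show "x \<in> E \<inter> cball 0 1" by (simp add: E_def)
  qed
  have fmE: "E \<inter> cball 0 \<rho> \<in> fmeasurable lborel" for \<rho>
    using E by (intro fmeasurable_lborel_bounded) auto
  have fmW: "W \<inter> cball 0 \<rho> \<in> fmeasurable lborel" for \<rho>
    using Wm by (intro fmeasurable_lborel_bounded) auto
  have "0 < measure lborel (cball ((1/2) *\<^sub>R e) (1/2))"
    by (rule content_cball_pos) simp
  also have "\<dots> \<le> measure lborel (E \<inter> cball 0 1)"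
    using cball_half fmE by (intro measure_mono_fmeasurable) auto
  finally have posE: "0 < measure lborel (E \<inter> cball 0 1)" .
  have H_iff: "x \<in> ?H \<longleftrightarrow> x \<in> E \<and> (x \<bullet> e + t)\<^sup>2 + (norm (perp e x))\<^sup>2 \<le> r\<^sup>2" for x
    using norm_add_axis[OF e1, of x t] r abs_le_square_iff[of "norm (x + t *\<^sub>R e)" r]
    by (simp add: half_lense_def E_def zero_le_mult_iff)
  have H_ball: "?H \<subseteq> cball 0 (r + t)"
  proof
    fix x assume "x \<in> ?H"
    then show "x \<in> cball 0 (r + t)"
      using norm_triangle_ineq4[of "x + t *\<^sub>R e" "t *\<^sub>R e"] e1 r by (simp add: half_lense_def)
  qed
  have Hm: "?H \<in> sets borel" unfolding half_lense_def by measurable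
  have fmH: "?H \<in> fmeasurable lborel"
    using Hm H_ball bounded_subset[OF bounded_cball] by (intro fmeasurable_lborel_bounded) auto
  have "E \<inter> cball 0 (r - t) \<subseteq> ?H"
  proof
    fix x assume "x \<in> E \<inter> cball 0 (r - t)"
    then show "x \<in> ?H"
      using norm_triangle_ineq[of x "t *\<^sub>R e"] e1 r by (auto simp: half_lense_def E_def zero_le_mult_iff)
  qed
  then have "measure lborel (E \<inter> cball 0 (r - t)) \<le> measure lborel ?H"
    using fmH fmeasurableD[OF fmE] by (intro measure_mono_fmeasurable) auto
  moreover have "0 < measure lborel (E \<inter> cball 0 (r - t))"
    using measure_scale_conic_Int_cball[OF E, of "r - t"] posE r by simp
  ultimately have posH: "0 < measure lborel ?H" by simp
  \<comment> \<open>The radius for which the half ball has the volume of the half lense.\<close>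
  define R where "R = root DIM('a) (measure lborel ?H / measure lborel (E \<inter> cball 0 1))"
  have R: "R > 0" "R ^ DIM('a) = measure lborel ?H / measure lborel (E \<inter> cball 0 1)"
    using posE posH by (auto simp: R_def)
  let ?B = "E \<inter> cball 0 R"
  have eqHB: "measure lborel ?H = measure lborel ?B"
    using measure_scale_conic_Int_cball[OF E R(1)] R(2) posE by simp
  define SH SB :: "(real \<times> real) set"
    where "SH = {p. 0 \<le> fst p \<and> (fst p + t)\<^sup>2 + (snd p)\<^sup>2 \<le> r\<^sup>2}"
      and "SB = {p. 0 \<le> fst p \<and> (fst p)\<^sup>2 + (snd p)\<^sup>2 \<le> R\<^sup>2}"
  have [measurable]: "SH \<in> sets borel" "SB \<in> sets borel"
    unfolding SH_def SB_def
    by (intro borel_closed closed_Collect_conj closed_Collect_le continuous_intros)+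
  have H: "?H = axial_coords e -` SH"
    by (rule set_eqI) (simp only: H_iff SH_def axial_coords_def E_def vimage_eq mem_Collect_eq fst_conv snd_conv)
  have ball_iff: "norm x \<le> R \<longleftrightarrow> (x \<bullet> e)\<^sup>2 + (norm (perp e x))\<^sup>2 \<le> R\<^sup>2" for x
    unfolding norm_axial_decomp[OF e1, symmetric] using R by simp
  have B: "?B = axial_coords e -` SB"
    by (rule set_eqI) (simp only: ball_iff SB_def axial_coords_def E_def vimage_eq mem_Collect_eq
        fst_conv snd_conv Int_iff mem_cball_0)
  have eq_diff: "measure lborel (?H - ?B) = measure lborel (?B - ?H)"
    using measure_diff_eq_difference[OF fmH fmE[of R]] eqHB by simp
  \<comment> \<open>The common points of the spheres that bound the two bodies lie in the plane \<open>x \<bullet> e = a\<close>.\<close>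
  define a where "a = (r\<^sup>2 - t\<^sup>2 - R\<^sup>2) / (2 * t)"
  \<comment> \<open>The round cone through the common points of the two spheres. If \<open>a \<le> 0\<close> then \<open>SH - SB\<close> is empty, and if \<open>a \<ge> R\<close> then \<open>SB - SH\<close> is; these cases get the plane \<open>s = 0\<close> and the axis itself.\<close>
  define c k where "c = max 0 a" and "k = (if c = 0 then 1 else sqrt (max 0 (R\<^sup>2 - c\<^sup>2)))"
  have ck: "c \<ge> 0" "k \<ge> 0" by (simp_all add: c_def k_def)
  have ck_pos: "c + k > 0"
  proof (cases "c = 0")
    case True
    then show ?thesis by (simp add: k_def)
  next
    case False
    with ck show ?thesis by linarith
  qed
  have expand: "(s + t)\<^sup>2 + \<rho>\<^sup>2 = s\<^sup>2 + \<rho>\<^sup>2 + s * (2 * t) + t\<^sup>2" for s \<rho>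
    by (simp add: power2_sum)
  \<comment> \<open>On either side of the plane, one of the two spheres lies inside the other.\<close>
  have SH_SB: "s < a" "0 \<le> s" "R\<^sup>2 < s\<^sup>2 + \<rho>\<^sup>2" if "(s, \<rho>) \<in> SH - SB" for s \<rho>
  proof -
    show "0 \<le> s" "R\<^sup>2 < s\<^sup>2 + \<rho>\<^sup>2" using that by (auto simp: SH_def SB_def)
    then have "s * (2 * t) < r\<^sup>2 - t\<^sup>2 - R\<^sup>2"
      using that expand[of s \<rho>] by (simp add: SH_def)
    then show "s < a" using r by (simp add: a_def pos_less_divide_eq)
  qed
  have SB_SH: "a < s" "0 \<le> s" "s\<^sup>2 + \<rho>\<^sup>2 \<le> R\<^sup>2" if "(s, \<rho>) \<in> SB - SH" for s \<rho>
  proof -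
    show "0 \<le> s" "s\<^sup>2 + \<rho>\<^sup>2 \<le> R\<^sup>2" using that by (auto simp: SB_def)
    then have "r\<^sup>2 - t\<^sup>2 - R\<^sup>2 < s * (2 * t)"
      using that expand[of s \<rho>] by (simp add: SH_def)
    then show "a < s" using r by (simp add: a_def pos_divide_less_eq)
  qed
  have outer: "k * s \<le> c * \<rho>" if *: "(s, \<rho>) \<in> SH - SB" "0 \<le> \<rho>" for s \<rho>
  proof -
    have s: "s < c" "0 \<le> s" "R\<^sup>2 < s\<^sup>2 + \<rho>\<^sup>2" using SH_SB[OF *(1)] by (auto simp: c_def)
    show "k * s \<le> c * \<rho>"
    proof (cases "c < R")
      case True
      have "(k * s)\<^sup>2 = R\<^sup>2 * s\<^sup>2 - c\<^sup>2 * s\<^sup>2"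
        using True s ck power_mono[of c R 2] by (simp add: k_def power_mult_distrib algebra_simps)
      also have "\<dots> \<le> R\<^sup>2 * c\<^sup>2 - c\<^sup>2 * s\<^sup>2"
        using s power_mono[of s c 2] by (simp add: mult_left_mono)
      also have "\<dots> \<le> (s\<^sup>2 + \<rho>\<^sup>2) * c\<^sup>2 - c\<^sup>2 * s\<^sup>2"
        using s by (intro diff_right_mono mult_right_mono) auto
      also have "\<dots> = (c * \<rho>)\<^sup>2" by (simp add: power_mult_distrib algebra_simps)
      finally show ?thesis by (rule power2_le_imp_le[OF _ mult_nonneg_nonneg[OF ck(1) *(2)]])
    next
      case False
      then have "k = 0" using s R power_mono[of R c 2] by (auto simp: k_def)
      then show ?thesis using ck *(2) by simp
    qed
  qed
  have inner: "0 \<le> s \<and> c * \<rho> \<le> k * s" if *: "(s, \<rho>) \<in> SB - SH" "0 \<le> \<rho>" for s \<rho>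
  proof -
    have s: "c \<le> s" "0 \<le> s" "s\<^sup>2 + \<rho>\<^sup>2 \<le> R\<^sup>2" using SB_SH[OF *(1)] by (auto simp: c_def)
    have "c * \<rho> \<le> k * s"
    proof (cases "c = 0")
      case True
      then show ?thesis using ck s by simp
    next
      case False
      have "c\<^sup>2 \<le> s\<^sup>2" using s ck by (intro power_mono) auto
      then have "c\<^sup>2 \<le> R\<^sup>2" using s by (simp add: order_trans[OF _ s(3)] add_increasing2)
      have "(c * \<rho>)\<^sup>2 = c\<^sup>2 * (s\<^sup>2 + \<rho>\<^sup>2) - c\<^sup>2 * s\<^sup>2" by (simp add: power_mult_distrib algebra_simps)
      also have "\<dots> \<le> c\<^sup>2 * R\<^sup>2 - c\<^sup>2 * s\<^sup>2" using s by (simp add: mult_left_mono)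
      also have "\<dots> \<le> s\<^sup>2 * R\<^sup>2 - c\<^sup>2 * s\<^sup>2" using \<open>c\<^sup>2 \<le> s\<^sup>2\<close> by (simp add: mult_right_mono)
      also have "\<dots> = (k * s)\<^sup>2"
        using False \<open>c\<^sup>2 \<le> R\<^sup>2\<close> by (simp add: k_def power_mult_distrib algebra_simps)
      finally show ?thesis by (rule power2_le_imp_le[OF _ mult_nonneg_nonneg[OF ck(2) s(2)]])
    qed
    with s show ?thesis by simp
  qed
  have "measure lborel (W \<inter> axial_coords e -` (SH - SB)) \<le> measure lborel (W \<inter> axial_coords e -` (SB - SH))"
  proof (rule measure_convex_cone_outer_le_inner[OF e dim W(1-3) _ _ ck(2) ck_pos outer inner])
    show "measure lborel (axial_coords e -` (SH - SB)) = measure lborel (axial_coords e -` (SB - SH))"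
      using eq_diff by (simp add: H B vimage_Diff)
    show "bounded (axial_coords e -` (SH - SB))"
      using bounded_subset[OF bounded_cball H_ball] by (auto simp: H vimage_Diff intro: bounded_diff)
    show "bounded (axial_coords e -` (SB - SH))"
      using bounded_Int[of E "cball 0 R"] by (auto simp: B vimage_Diff intro: bounded_diff)
  qed auto
  then have "measure lborel (W \<inter> ?H - W \<inter> ?B) \<le> measure lborel (W \<inter> ?B - W \<inter> ?H)"
    by (simp add: H B vimage_Diff Diff_Int_distrib)
  then have "measure lborel (W \<inter> ?H) \<le> measure lborel (W \<inter> ?B)"
    using measure_diff_eq_difference[of "W \<inter> ?H" lborel "W \<inter> ?B"] fmH fmE[of R] Wm
    by (simp add: fmeasurable_Int_fmeasurable Int_commute[of W])
  also have "W \<inter> ?B = W \<inter> cball 0 R" using W(4) by (auto simp: E_def)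
  also have "measure lborel (W \<inter> cball 0 R) = R ^ DIM('a) * measure lborel (W \<inter> cball 0 1)"
    using W(2) Wm R by (intro measure_scale_conic_Int_cball) (auto simp: convex_cone_def)
  finally show ?thesis
    using posE by (simp add: R(2) field_simps E_def)
qed

section \<open>Arbitrary axes\<close>

text \<open>The reflection that exchanges \<open>a\<close> and \<open>b\<close>.\<close>

lemma exists_orthogonal_transformation_map:
  fixes a b :: "'a::euclidean_space"
  assumes "norm a = norm b"
  obtains f where "orthogonal_transformation f" "f a = b"
proof (cases "a = b")
  case True
  then show ?thesis using that[of "\<lambda>x. x"] by simp
next
  case False
  define v where "v = a - b"
  define f where "f x = x - (2 * (x \<bullet> v) / (v \<bullet> v)) *\<^sub>R v" for x
  have v: "v \<bullet> v \<noteq> 0" using False by (simp add: v_def)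
  have aabb: "a \<bullet> a = b \<bullet> b"
    using assms by (simp add: power2_norm_eq_inner[symmetric])
  have "linear f"
    unfolding f_def by (intro linearI) (auto simp: inner_add_left algebra_simps add_divide_distrib)
  moreover have "f x \<bullet> f y = x \<bullet> y" for x y
    using v by (simp add: f_def inner_diff_left inner_diff_right inner_commute field_simps)
  ultimately have "orthogonal_transformation f"
    by (simp add: orthogonal_transformation_def)
  moreover have "2 * (a \<bullet> v) = v \<bullet> v"
    using aabb by (simp add: v_def inner_diff_left inner_diff_right inner_commute)
  then have "f a = b"
    using v by (simp add: f_def v_def)
  ultimately show ?thesis using that by blast
qed

lemma half_lense_vimage:
  assumes "orthogonal_transformation f"
  shows "f -` half_lense (f q) r = half_lense q r"
  using assms unfolding half_lense_def orthogonal_transformation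
  by (auto simp: orthogonal_transformation_def[THEN iffD1, OF assms] simp flip: linear_diff)

lemma half_lense_borel [measurable]: "half_lense q r \<in> sets borel"
  unfolding half_lense_def by measurable

lemma measure_half_lense_cong:
  fixes q q' :: "'a::euclidean_space"
  assumes "norm q = norm q'"
  shows "measure lborel (half_lense q r) = measure lborel (half_lense q' r)"
proof -
  obtain f where "orthogonal_transformation f" "f q = q'"
    using exists_orthogonal_transformation_map[OF assms] .
  then show ?thesis
    using orthogonal_transformation_measure_lborel[of f "half_lense q' r"] half_lense_vimage[of f q r] by simp
qed

definition half_ball :: "'a::euclidean_space \<Rightarrow> 'a set" where
  "half_ball q = {x. x \<bullet> q \<le> 0} \<inter> cball 0 1"

lemma half_ball_borel [measurable]: "half_ball q \<in> sets borel"
  unfolding half_ball_def by measurable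

lemma half_ball_vimage:
  assumes "orthogonal_transformation f"
  shows "f -` half_ball (f q) = half_ball q"
  using assms unfolding half_ball_def orthogonal_transformation
  by (auto simp: orthogonal_transformation_def[THEN iffD1, OF assms])

lemma measure_half_ball_cong:
  fixes q q' :: "'a::euclidean_space"
  assumes "norm q = norm q'"
  shows "measure lborel (half_ball q) = measure lborel (half_ball q')"
proof -
  obtain f where "orthogonal_transformation f" "f q = q'"
    using exists_orthogonal_transformation_map[OF assms] .
  then show ?thesis
    using orthogonal_transformation_measure_lborel[of f "half_ball q'"] half_ball_vimage[of f q] by simp
qed

lemma measure_ball_le_half_ball:
  "measure lborel (cball (0::'a::euclidean_space) 1) \<le> 2 * measure lborel (half_ball (q::'a))"
proof -
  have "cball 0 1 = half_ball q \<union> half_ball (- q)"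
    by (auto simp: half_ball_def)
  then have "measure lborel (cball (0::'a) 1) \<le> measure lborel (half_ball q) + measure lborel (half_ball (- q))"
    using measure_Un_le[of "half_ball q" lborel "half_ball (- q)"] by simp
  then show ?thesis
    using measure_half_ball_cong[of q "- q"] by simp
qed

text \<open>An orthogonal transformation carries the axis to a basis vector, for which the effect of axial
  scaling on Lebesgue measure can be read off coordinatewise.\<close>

lemma measure_convex_cone_Int_half_lense:
  fixes q :: "'a::euclidean_space"
  assumes dim: "DIM('a) > 1" and q: "0 < norm q" "norm q < r"
    and W: "closed W" "convex_cone W" "- q \<in> W" "\<And>x. x \<in> W \<Longrightarrow> x \<bullet> q \<le> 0"
  shows "measure lborel (W \<inter> half_lense q r) * measure lborel (half_ball q)
    \<le> measure lborel (W \<inter> cball 0 1) * measure lborel (half_lense q r)"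
proof -
  define t where "t = norm q"
  have t: "0 < t" "t < r" using q by (auto simp: t_def)
  obtain e :: 'a where e: "e \<in> Basis" by (meson nonempty_Basis ex_in_conv)
  then have "norm (- (t *\<^sub>R e)) = norm q" by (simp add: t_def)
  then obtain f where f: "orthogonal_transformation f" "f (- (t *\<^sub>R e)) = q"
    by (rule exists_orthogonal_transformation_map)
  have lin: "linear f" and inner: "\<And>x y. f x \<bullet> f y = x \<bullet> y"
    using f(1) by (auto simp: orthogonal_transformation_def)
  have q_eq: "q = - (t *\<^sub>R f e)"
    using f(2) by (simp add: linear_neg[OF lin] linear_scale[OF lin])
  have [measurable]: "W \<in> sets borel" using W(1) by (simp add: borel_closed)
  let ?q = "- (t *\<^sub>R e)"
  have pre: "f -` cball 0 1 = cball 0 1" "f -` half_lense q r = half_lense ?q r" "f -` half_ball q = half_ball ?q"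
    using f(1) half_lense_vimage[OF f(1), of ?q] half_ball_vimage[OF f(1), of ?q] f(2)
    by (auto simp: orthogonal_transformation)
  have meas: "measure lborel (W \<inter> half_lense q r) = measure lborel (f -` W \<inter> half_lense ?q r)"
    "measure lborel (W \<inter> cball 0 1) = measure lborel (f -` W \<inter> cball 0 1)"
    "measure lborel (half_lense q r) = measure lborel (half_lense ?q r)"
    "measure lborel (half_ball q) = measure lborel (half_ball ?q)"
    by (subst orthogonal_transformation_measure_lborel[OF f(1), symmetric]; simp add: pre vimage_Int)+
  have half_ball: "half_ball ?q = {x. x \<bullet> e \<ge> 0} \<inter> cball 0 1"
    using t by (auto simp: half_ball_def zero_le_mult_iff)
  show ?thesis
    unfolding meas unfolding half_ball
  proof (rule measure_convex_cone_Int_half_lense_axis[OF e dim t])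
    show "closed (f -` W)"
      using W(1) lin by (intro closed_vimage linear_continuous_on linear_conv_bounded_linear[THEN iffD1])
    show "convex_cone (f -` W)"
      using W(2) by (auto simp: convex_cone_iff linear_add[OF lin] linear_scale[OF lin] linear_0[OF lin])
    show "e \<in> f -` W"
      using W(3) convex_cone_scaleR_iff[OF W(2) t(1), of "f e"] by (simp add: q_eq)
    show "x \<bullet> e \<ge> 0" if "x \<in> f -` W" for x
      using W(4)[of "f x"] that t by (simp add: q_eq inner zero_le_mult_iff)
  qed
qed

section \<open>Ball bodies of balanced points on a sphere\<close>

text \<open>For points \<open>C\<close> on a sphere around the origin, this is the cell of \<open>q\<close> in the farthest-point Voronoi
  diagram of \<open>C\<close>: with equal norms, being farther from \<open>q\<close> means having smaller inner product with \<open>q\<close>.\<close>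

definition far_cell :: "'a::euclidean_space set \<Rightarrow> 'a \<Rightarrow> 'a set" where
  "far_cell C q = {x. \<forall>q'\<in>C. x \<bullet> q \<le> x \<bullet> q'}"

lemma closed_far_cell: "closed (far_cell C q)"
proof -
  have "far_cell C q = (\<Inter>q'\<in>C. {x. x \<bullet> q \<le> x \<bullet> q'})"
    by (auto simp: far_cell_def)
  then show ?thesis
    by (auto intro!: closed_INT closed_Collect_le continuous_intros)
qed

lemma convex_cone_far_cell: "convex_cone (far_cell C q)"
  by (auto simp: convex_cone_iff far_cell_def inner_add_left add_mono mult_left_mono)

lemma negligible_far_cell_Int:
  assumes "q \<in> C" "q' \<in> C" "q \<noteq> q'"
  shows "negligible (far_cell C q \<inter> far_cell C q')"
proof (rule negligible_subset)
  show "negligible {x. (q - q') \<bullet> x = 0}"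
    using assms by (intro negligible_hyperplane) simp
  show "far_cell C q \<inter> far_cell C q' \<subseteq> {x. (q - q') \<bullet> x = 0}"
    using assms by (auto simp: far_cell_def inner_diff_right inner_commute[of "q - q'"] intro: antisym)
qed

lemma UN_far_cell:
  assumes "finite C" "C \<noteq> {}"
  shows "(\<Union>q\<in>C. far_cell C q) = UNIV"
proof -
  have "\<exists>q\<in>C. x \<in> far_cell C q" for x
  proof -
    have "Min ((\<lambda>q. x \<bullet> q) ` C) \<in> (\<lambda>q. x \<bullet> q) ` C"
      using assms by (intro Min_in) auto
    then obtain q where q: "q \<in> C" "x \<bullet> q = Min ((\<lambda>q. x \<bullet> q) ` C)" by auto
    then have "x \<in> far_cell C q"
      using assms by (simp add: far_cell_def)
    with q show ?thesis by blast
  qed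
  then show ?thesis by blast
qed

text \<open>Within the cell of \<open>q\<close> the ball body lies in the half lense of \<open>q\<close>, because some point of \<open>C\<close>, and so
  also the minimizing point \<open>q\<close>, has nonpositive inner product with a given vector. The bound for one
  cell is summed over the cells, which tile the unit ball.\<close>

lemma measure_ball_body_balanced_le:
  fixes C :: "'a::euclidean_space set"
  assumes dim: "DIM('a) > 1" and C: "finite C" "C \<subseteq> sphere 0 t"
    and balanced: "\<And>u. \<exists>q\<in>C. q \<bullet> u \<le> 0"
    and t: "0 < t" "t < r" and q0: "norm q0 = t"
  shows "measure lborel (ball_body r C) \<le> 2 * measure lborel (half_lense (q0::'a) r)"
proof -
  have "C \<noteq> {}" using balanced by blast
  let ?K = "ball_body r C" and ?W = "far_cell C" and ?B = "cball (0::'a) 1"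
  let ?h = "measure lborel (half_lense q0 r)" and ?\<beta> = "measure lborel (half_ball q0)"
  have Km [measurable]: "?K \<in> sets borel"
    unfolding ball_body_def using C by (intro borel_closed closed_INT) auto
  have Wm [measurable]: "?W q \<in> sets borel" for q
    using closed_far_cell by (rule borel_closed)
  have normC: "norm q = t" if "q \<in> C" for q using C that by auto
  have W_neg: "x \<bullet> q \<le> 0" if "q \<in> C" "x \<in> ?W q" for x q
    using balanced[of x] that by (force simp: far_cell_def inner_commute)
  have W_axis: "- q \<in> ?W q" if "q \<in> C" for q
  proof -
    have "q \<bullet> q' \<le> q \<bullet> q" if "q' \<in> C" for q'
      using norm_cauchy_schwarz[of q q'] normC[OF that] normC[OF \<open>q \<in> C\<close>]
      by (simp add: power2_norm_eq_inner[symmetric] power2_eq_square)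
    then show ?thesis by (simp add: far_cell_def)
  qed
  have cells_cover: "(\<Union>q\<in>C. ?W q \<inter> X) = X" for X
    using UN_far_cell[OF C(1) \<open>C \<noteq> {}\<close>] by blast
  have cell: "measure lborel (?W q \<inter> ?K) * ?\<beta> \<le> measure lborel (?W q \<inter> ?B) * ?h" if q: "q \<in> C" for q
  proof -
    have "half_lense q r \<subseteq> cball q r"
      by (auto simp: half_lense_def dist_norm norm_minus_commute)
    then have fm: "?W q \<inter> half_lense q r \<in> fmeasurable lborel"
      by (intro fmeasurable_lborel_bounded bounded_subset[OF bounded_cball[of q r]]) auto
    have "?W q \<inter> ?K \<subseteq> ?W q \<inter> half_lense q r"
      using W_neg[OF q] q by (auto simp: half_lense_def ball_body_def dist_norm norm_minus_commute)
    then have "measure lborel (?W q \<inter> ?K) * ?\<beta> \<le> measure lborel (?W q \<inter> half_lense q r) * measure lborel (half_ball q)"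
      using fm normC[OF q] q0 measure_half_ball_cong[of q q0]
      by (auto intro!: mult_right_mono measure_mono_fmeasurable)
    also have "\<dots> \<le> measure lborel (?W q \<inter> ?B) * measure lborel (half_lense q r)"
      using dim t normC[OF q] W_axis[OF q] W_neg[OF q]
      by (intro measure_convex_cone_Int_half_lense closed_far_cell convex_cone_far_cell) auto
    finally show ?thesis
      using normC[OF q] q0 measure_half_lense_cong[of q q0] by simp
  qed
  have "measure lborel ?K = measure lborel (\<Union>q\<in>C. ?W q \<inter> ?K)"
    by (simp only: cells_cover)
  also have "\<dots> \<le> (\<Sum>q\<in>C. measure lborel (?W q \<inter> ?K))"
    using C by (intro measure_UNION_le) auto
  finally have "measure lborel ?K * ?\<beta> \<le> (\<Sum>q\<in>C. measure lborel (?W q \<inter> ?K)) * ?\<beta>"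
    by (intro mult_right_mono) auto
  also have "\<dots> \<le> (\<Sum>q\<in>C. measure lborel (?W q \<inter> ?B)) * ?h"
    unfolding sum_distrib_right by (intro sum_mono cell)
  also have "(\<Sum>q\<in>C. measure lborel (?W q \<inter> ?B)) = measure lebesgue (\<Union>q\<in>C. ?W q \<inter> ?B)"
  proof (subst measure_negligible_finite_Union_image[OF C(1)])
    show "?W q \<inter> ?B \<in> lmeasurable" for q
      by (intro lmeasurable_compact closed_Int_compact closed_far_cell compact_cball)
    show "pairwise (\<lambda>q q'. negligible (?W q \<inter> ?B \<inter> (?W q' \<inter> ?B))) C"
      by (rule pairwiseI, rule negligible_subset[OF negligible_far_cell_Int]) auto
  qed simp
  also have "(\<Union>q\<in>C. ?W q \<inter> ?B) = ?B"
    by (simp only: cells_cover)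
  also have "measure lebesgue ?B * ?h \<le> 2 * ?\<beta> * ?h"
    using measure_ball_le_half_ball[of q0] by (intro mult_right_mono) auto
  finally have "measure lborel ?K * ?\<beta> \<le> (2 * ?h) * ?\<beta>" by (simp add: mult_ac)
  moreover have "?\<beta> > 0"
    using measure_ball_le_half_ball[of q0] content_cball_pos[OF zero_less_one, of "0::'a"] by linarith
  ultimately show ?thesis by simp
qed

section \<open>The circumcenter and the lense\<close>

text \<open>Compactness gives a center that attains the infimum. If every point at maximal distance had
  positive inner product with \<open>u\<close>, moving the center a little in direction \<open>u\<close> would bring all points
  strictly closer than the circumradius.\<close>

lemma circumcenter_exists:
  fixes P :: "'a::euclidean_space set"
  assumes P: "finite P" "P \<noteq> {}"
  obtains c where "P \<subseteq> cball c (circumradius P)"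
    and "\<And>u. \<exists>p\<in>P. dist p c = circumradius P \<and> (p - c) \<bullet> u \<le> 0"
proof -
  define Rs where "Rs = {R. R \<ge> 0 \<and> (\<exists>c. P \<subseteq> cball c R)}"
  let ?R = "circumradius P"
  have R_Inf: "?R = Inf Rs" by (simp add: circumradius_def Rs_def)
  have "bounded P" using P by (simp add: finite_imp_bounded)
  then obtain R1 where "R1 > 0" "P \<subseteq> cball 0 R1"
    by (auto simp: bounded_pos subset_iff)
  then have Rs_ne: "Rs \<noteq> {}" by (auto simp: Rs_def intro!: exI[of _ R1])
  have Rs_bdd: "bdd_below Rs" by (rule bdd_belowI[of _ 0]) (simp add: Rs_def)
  define S where "S n = ball_body (?R + 1 / real (Suc n)) P" for n
  have S_iff: "c \<in> S n \<longleftrightarrow> P \<subseteq> cball c (?R + 1 / real (Suc n))" for c n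
    by (auto simp: S_def ball_body_def dist_commute)
  obtain c where c: "\<And>n. c \<in> S n"
  proof (rule bounded_closed_nest)
    show "closed (S n)" for n
      unfolding S_def ball_body_def by (intro closed_INT) auto
    show "S n \<noteq> {}" for n
    proof -
      have "Inf Rs < ?R + 1 / real (Suc n)" by (simp add: R_Inf)
      then obtain R where R: "R \<in> Rs" "R < ?R + 1 / real (Suc n)"
        using cInf_lessD[OF Rs_ne] by blast
      then obtain c where "P \<subseteq> cball c R" by (auto simp: Rs_def)
      with R(2) have "c \<in> S n"
        unfolding S_iff using subset_cball[of R "?R + 1 / real (Suc n)" c] by auto
      then show ?thesis by blast
    qed
    show "S n \<subseteq> S m" if "m \<le> n" for m n
    proof -
      have "1 / real (Suc n) \<le> 1 / real (Suc m)" using that by (simp add: field_simps)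
      then have "cball c (?R + 1 / real (Suc n)) \<subseteq> cball c (?R + 1 / real (Suc m))" for c :: 'a
        by (intro subset_cball) simp
      then show ?thesis by (metis S_iff subsetI subset_trans)
    qed
    obtain p where "p \<in> P" using P by blast
    then have "S 0 \<subseteq> cball p (?R + 1)" by (auto simp: S_def ball_body_def)
    then show "bounded (S 0)" using bounded_subset[OF bounded_cball] by blast
  qed blast
  have sub: "P \<subseteq> cball c ?R"
  proof
    fix p assume "p \<in> P"
    then have "dist c p - ?R \<le> 1 / real (Suc n)" for n
      using c[of n] by (auto simp: S_iff)
    then have "dist c p - ?R \<le> 0"
      using lim_const_over_n[of 1, THEN LIMSEQ_Suc]
      by (intro LIMSEQ_le_const[where X = "\<lambda>n. 1 / real (Suc n)"]) auto
    then show "p \<in> cball c ?R" by simp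
  qed
  have "\<exists>p\<in>P. dist p c = ?R \<and> (p - c) \<bullet> u \<le> 0" for u
  proof (rule ccontr)
    assume "\<not> ?thesis"
    then have contact: "(p - c) \<bullet> u > 0" if "p \<in> P" "dist p c = ?R" for p
      using that by force
    have "\<forall>\<^sub>F s in at_right 0. \<forall>p\<in>P. dist p (c + s *\<^sub>R u) < ?R"
    proof (rule eventually_ball_finite[OF P(1)], intro ballI)
      fix p assume p: "p \<in> P"
      show "\<forall>\<^sub>F s in at_right 0. dist p (c + s *\<^sub>R u) < ?R"
      proof (cases "dist p c = ?R")
        case True
        have "((\<lambda>s. s * (u \<bullet> u)) \<longlongrightarrow> 0 * (u \<bullet> u)) (at_right (0::real))"
          by (intro tendsto_intros)
        then have "\<forall>\<^sub>F s in at_right 0. s * (u \<bullet> u) < 2 * ((p - c) \<bullet> u)"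
          using contact[OF p True] by (auto intro: order_tendstoD)
        moreover have "\<forall>\<^sub>F s in at_right (0::real). s > 0"
          by (simp add: eventually_at_right_less)
        ultimately show ?thesis
        proof eventually_elim
          case (elim s)
          have "(dist p (c + s *\<^sub>R u))\<^sup>2 = (dist p c)\<^sup>2 - s * (2 * ((p - c) \<bullet> u) - s * (u \<bullet> u))"
            by (simp add: dist_norm power2_norm_eq_inner inner_diff_left inner_diff_right
                inner_add_left inner_add_right inner_commute algebra_simps)
          also have "\<dots> < (dist p c)\<^sup>2" using elim by simp
          finally show ?case unfolding True[symmetric] by (rule power2_less_imp_less) simp
        qed
      next
        case False
        then have "dist p c < ?R" using sub p by (auto simp: dist_commute)
        moreover have "((\<lambda>s. dist p (c + s *\<^sub>R u)) \<longlongrightarrow> dist p (c + 0 *\<^sub>R u)) (at_right 0)"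
          by (intro tendsto_intros)
        ultimately show ?thesis by (auto intro: order_tendstoD)
      qed
    qed
    then obtain s where s: "\<And>p. p \<in> P \<Longrightarrow> dist p (c + s *\<^sub>R u) < ?R"
      using eventually_happens'[OF trivial_limit_at_right_real] by blast
    define m where "m = Max ((\<lambda>p. dist p (c + s *\<^sub>R u)) ` P)"
    have "m \<in> (\<lambda>p. dist p (c + s *\<^sub>R u)) ` P"
      unfolding m_def using P by (intro Max_in) auto
    then have "m < ?R" "m \<ge> 0" using s by auto
    moreover have "P \<subseteq> cball (c + s *\<^sub>R u) m"
      using P by (auto simp: m_def dist_commute)
    ultimately have "m \<in> Rs" by (auto simp: Rs_def)
    then have "?R \<le> m" unfolding R_Inf using Rs_bdd by (rule cInf_lower)
    with \<open>m < ?R\<close> show False by simp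
  qed
  with sub that show ?thesis by blast
qed

text \<open>Centered at the midpoint of \<open>a\<close> and \<open>b\<close>, the lense contains two opposite half lenses, which overlap
  only in a hyperplane: a point with nonpositive inner product with \<open>q\<close> is nearer to \<open>- q\<close> than to \<open>q\<close>.\<close>

lemma measure_lense_ge:
  fixes a b :: "'a::euclidean_space"
  assumes "a \<noteq> b"
  shows "2 * measure lborel (half_lense ((1/2) *\<^sub>R (a - b)) r) \<le> measure lebesgue (cball a r \<inter> cball b r)"
proof -
  define q where "q = (1/2) *\<^sub>R (a - b)"
  have "q \<noteq> 0" using assms by (simp add: q_def)
  have bd: "bounded (half_lense q' r)" for q' :: 'a
    by (rule bounded_subset[of "cball q' r"]) (auto simp: half_lense_def dist_norm norm_minus_commute)
  have fm: "half_lense q' r \<in> lmeasurable" for q' :: 'a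
    using bd by (intro bounded_set_imp_lmeasurable) auto
  have "negligible (half_lense q r \<inter> half_lense (- q) r)"
  proof (rule negligible_subset)
    show "negligible {x. q \<bullet> x = 0}" using \<open>q \<noteq> 0\<close> by (intro negligible_hyperplane) simp
  qed (auto simp: half_lense_def inner_commute)
  then have "measure lebesgue (half_lense q r \<union> half_lense (- q) r)
      = measure lebesgue (half_lense q r) + measure lebesgue (half_lense (- q) r)"
    using measure_Un3[OF fm fm] by (simp only: negligible_imp_measure0)
  also have "\<dots> = 2 * measure lborel (half_lense q r)"
    using measure_half_lense_cong[of q "- q" r] by simp
  finally have "2 * measure lborel (half_lense q r) = measure lebesgue (half_lense q r \<union> half_lense (- q) r)" ..
  also have "\<dots> \<le> measure lebesgue (cball q r \<inter> cball (- q) r)"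
  proof (rule measure_mono_fmeasurable)
    have near: "norm (x + q') \<le> norm (x - q')" if "x \<bullet> q' \<le> 0" for x q' :: 'a
      using that by (simp add: norm_le inner_add_left inner_add_right inner_diff_left inner_diff_right inner_commute)
    have "norm (x + q') \<le> r" if "x \<in> half_lense q' r" for x q' :: 'a
      using that near[of x q'] by (simp add: half_lense_def)
    from this[of _ q] this[of _ "- q"]
    show "half_lense q r \<union> half_lense (- q) r \<subseteq> cball q r \<inter> cball (- q) r"
      by (auto simp: dist_norm half_lense_def norm_minus_commute add.commute)
  qed auto
  also have "\<dots> = measure lebesgue ((+) (midpoint a b) ` (cball q r \<inter> cball (- q) r))"
    by (simp add: measure_translation)
  also have "(+) (midpoint a b) ` (cball q r \<inter> cball (- q) r) = cball a r \<inter> cball b r"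
  proof -
    have "midpoint a b + q = a" "midpoint a b - q = b"
      by (simp_all add: midpoint_def q_def algebra_simps flip: scaleR_add_left)
    then show ?thesis
      by (simp add: image_Int add.commute[of q] flip: cball_translation)
  qed
  finally show ?thesis by (simp add: q_def)
qed

theorem theorem1:
  fixes r r\<^sub>0 :: real and N :: nat and p :: "nat \<Rightarrow> 'a::euclidean_space" and P L :: "'a set"
  assumes "r > r\<^sub>0" and "r\<^sub>0 > 0"
    and "N > 1" and "DIM('a) > 1"
    and "P = p ` {1..N}"
    and "circumradius P = r\<^sub>0"
    and "is_lense r L" and "inradius L = r - r\<^sub>0"
  shows "measure lebesgue (ball_body r P) \<le> measure lebesgue L"
proof -
  have P: "finite P" "P \<noteq> {}" using assms by auto
  obtain c where "P \<subseteq> cball c r\<^sub>0" and c: "\<And>u. \<exists>p\<in>P. dist p c = r\<^sub>0 \<and> (p - c) \<bullet> u \<le> 0"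
    using circumcenter_exists[OF P] assms(6) by metis
  obtain a b where ab: "dist a b = 2 * r\<^sub>0" "L = cball a r \<inter> cball b r"
    using lense_inradius_iff[of "r - r\<^sub>0" r L] assms by auto
  define q0 where "q0 = (1/2) *\<^sub>R (a - b)"
  have q0: "norm q0 = r\<^sub>0" using ab by (simp add: q0_def dist_norm)
  define C where "C = (\<lambda>p. p - c) ` {p \<in> P. dist p c = r\<^sub>0}"
  have C: "finite C" "C \<subseteq> sphere 0 r\<^sub>0" "\<And>u. \<exists>q\<in>C. q \<bullet> u \<le> 0"
    using P c by (auto simp: C_def dist_norm norm_minus_commute)
  obtain q where "q \<in> C" using C(3) by blast
  have "ball_body r P \<subseteq> (+) c ` ball_body r C"
  proof
    fix x assume "x \<in> ball_body r P"
    then have "x - c \<in> ball_body r C" by (auto simp: ball_body_def C_def dist_norm)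
    then show "x \<in> (+) c ` ball_body r C" by (intro image_eqI[of _ _ "x - c"]) auto
  qed
  have compact_body: "compact (ball_body r X)" if "X \<noteq> {}" for X :: "'a set"
    unfolding ball_body_def using that by (intro compact_Inter) auto
  have "measure lebesgue (ball_body r P) \<le> measure lebesgue ((+) c ` ball_body r C)"
    using \<open>ball_body r P \<subseteq> _\<close> P \<open>q \<in> C\<close> compact_body[of P] compact_body[of C]
    by (intro measure_mono_fmeasurable lmeasurable_compact compact_translation)
       (auto intro: fmeasurableD lmeasurable_compact)
  also have "\<dots> = measure lborel (ball_body r C)"
    using compact_body[of C] \<open>q \<in> C\<close>
    by (subst measure_translation, subst measure_completion) (auto intro: borel_compact)
  also have "\<dots> \<le> 2 * measure lborel (half_lense q0 r)"
    using assms(1,2,4) C q0 by (intro measure_ball_body_balanced_le) auto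
  also have "\<dots> \<le> measure lebesgue L"
  proof -
    have "a \<noteq> b" using ab assms(2) by auto
    then show ?thesis using measure_lense_ge[of a b r] ab by (simp add: q0_def)
  qed
  finally show ?thesis .
qed

end
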